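(* Let $G$ be a non-archimedean abelian Polish group and let $(G_n)_{n\in\omega}$ be any decreasing sequence of open subgroups of $G$ which is a neighborhood base of the identity element of $G$. Then the following are equivalent: (i) $G$ involves $\mathbb{Z}^\omega$; (ii) $G$ has a closed subgroup isomorphic (as a topological group) to $\mathbb{Z}^\omega$; (iii) for infinitely many $n$, $G_n/G_{n+1}$ is not torsion.
   Context: A Polish group is non-archimedean if its identity element has a neighborhood base consisting of open subgroups. $G$ involves $H$ if there is a continuous surjective homomorphism from a closed subgroup of $G$ onto $H$. $\mathbb{Z}^\omega$ is the countable product of copies of the discrete group $\mathbb{Z}$ with the product topology. *)

theory Defs
  imports "HOL-Analysis.Analysis" "HOL-Algebra.Coset" "HOL-Algebra.Product_Groups"
begin

text \<open>A topological group is a HOL-Algebra group together with an abstract topology on its carrier.\<close>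

definition topological_group :: "('a, 'm) monoid_scheme \<Rightarrow> 'a topology \<Rightarrow> bool" where
  "topological_group G T \<longleftrightarrow>
     group G \<and> topspace T = carrier G \<and>
     continuous_map (prod_topology T T) T (\<lambda>(x, y). x \<otimes>\<^bsub>G\<^esub> y) \<and>
     continuous_map T T (\<lambda>x. inv\<^bsub>G\<^esub> x)"

definition polish_group :: "('a, 'm) monoid_scheme \<Rightarrow> 'a topology \<Rightarrow> bool" where
  "polish_group G T \<longleftrightarrow>
     topological_group G T \<and> separable_space T \<and> completely_metrizable_space T"

definition open_subgroup :: "'a set \<Rightarrow> ('a, 'm) monoid_scheme \<Rightarrow> 'a topology \<Rightarrow> bool" where
  "open_subgroup H G T \<longleftrightarrow> subgroup H G \<and> openin T H"

definition closed_subgroup :: "'a set \<Rightarrow> ('a, 'm) monoid_scheme \<Rightarrow> 'a topology \<Rightarrow> bool" where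
  "closed_subgroup H G T \<longleftrightarrow> subgroup H G \<and> closedin T H"

definition non_archimedean :: "('a, 'm) monoid_scheme \<Rightarrow> 'a topology \<Rightarrow> bool" where
  "non_archimedean G T \<longleftrightarrow>
     neighbourhood_base_at \<one>\<^bsub>G\<^esub> (\<lambda>V. open_subgroup V G T) T"

definition topological_group_iso ::
  "('a, 'm) monoid_scheme \<Rightarrow> 'a topology \<Rightarrow> ('b, 'n) monoid_scheme \<Rightarrow> 'b topology \<Rightarrow> bool" where
  "topological_group_iso G T H S \<longleftrightarrow> (\<exists>f. f \<in> iso G H \<and> homeomorphic_map T S f)"

definition involves ::
  "('a, 'm) monoid_scheme \<Rightarrow> 'a topology \<Rightarrow> ('b, 'n) monoid_scheme \<Rightarrow> 'b topology \<Rightarrow> bool" where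
  "involves G T H S \<longleftrightarrow>
     (\<exists>K f. closed_subgroup K G T \<and> f \<in> hom (G\<lparr>carrier := K\<rparr>) H \<and>
        continuous_map (subtopology T K) S f \<and> f ` K = carrier H)"

definition torsion_group :: "('a, 'm) monoid_scheme \<Rightarrow> bool" where
  "torsion_group G \<longleftrightarrow> (\<forall>x\<in>carrier G. \<exists>k::nat. k > 0 \<and> x [^]\<^bsub>G\<^esub> k = \<one>\<^bsub>G\<^esub>)"

definition Z_omega :: "(nat \<Rightarrow> int) monoid" where
  "Z_omega = product_group UNIV (\<lambda>_. integer_group)"

definition Z_omega_topology :: "(nat \<Rightarrow> int) topology" where
  "Z_omega_topology = product_topology (\<lambda>_. discrete_topology UNIV) UNIV"

end

theory Submission
  imports Defs
begin

text \<open>If infinitely many quotients are not torsion, pass to the subsequence of these quotients and choose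
  \<open>g k \<in> N k\<close> of infinite order modulo \<open>N (Suc k)\<close>; then the infinite product of the
  \<open>g k [^] x k\<close> is a topological embedding of \<open>\<int>\<^sup>\<omega>\<close>, because the product lies in \<open>N k\<close>
  exactly when the first \<open>k\<close> exponents vanish. Conversely, if all quotients from \<open>n0\<close> on are
  torsion, a continuous homomorphism \<open>f\<close> from \<open>K\<close> to \<open>\<int>\<^sup>\<omega>\<close> kills \<open>K \<inter> N n0\<close>: each coordinate of
  \<open>f\<close> vanishes on some \<open>N n\<close>, and \<open>\<int>\<close> is torsion free. By separability \<open>N n0\<close> has
  countable index, so \<open>f\<close> has countable image and is not surjective.\<close>

section \<open>The group of integer sequences and its topology\<close>

lemma carrier_Z_omega [simp]: "carrier Z_omega = UNIV"
  and mult_Z_omega [simp]: "x \<otimes>\<^bsub>Z_omega\<^esub> y = (\<lambda>i. x i + y i)"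
  by (auto simp: Z_omega_def integer_group_def product_group_def)

lemma topspace_Z_omega [simp]: "topspace Z_omega_topology = UNIV"
  by (simp add: Z_omega_topology_def)

text \<open>A basic open set constrains finitely many coordinates, hence contains a cylinder that
  fixes an initial segment. Initial segments are used because they will correspond to cosets of the
  \<open>N k\<close>.\<close>

lemma openin_Z_omega_iff:
  "openin Z_omega_topology W \<longleftrightarrow> (\<forall>x\<in>W. \<exists>k. \<forall>y. (\<forall>i<k. x i = y i) \<longrightarrow> y \<in> W)"
proof
  assume W: "openin Z_omega_topology W"
  show "\<forall>x\<in>W. \<exists>k. \<forall>y. (\<forall>i<k. x i = y i) \<longrightarrow> y \<in> W"
  proof
    fix x assume "x \<in> W"
    then obtain U where fin: "finite {i. U i \<noteq> UNIV}"
      and U: "x \<in> Pi\<^sub>E UNIV U" "Pi\<^sub>E UNIV U \<subseteq> W"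
      using W unfolding Z_omega_topology_def openin_product_topology_alt
      by (simp only: topspace_discrete_topology UNIV_I simp_thms) blast
    obtain k where k: "\<And>i. U i \<noteq> UNIV \<Longrightarrow> i < k"
      using fin unfolding finite_nat_iff_bounded by blast
    have "y \<in> W" if "\<forall>i<k. x i = y i" for y
    proof -
      have "y i \<in> U i" for i
      proof (cases "U i = UNIV")
        case False
        then have "x i = y i" using k that by blast
        then show ?thesis using U(1) by (metis PiE_mem UNIV_I)
      qed simp
      then show ?thesis using U(2) by auto
    qed
    then show "\<exists>k. \<forall>y. (\<forall>i<k. x i = y i) \<longrightarrow> y \<in> W" by blast
  qed
next
  assume R: "\<forall>x\<in>W. \<exists>k. \<forall>y. (\<forall>i<k. x i = y i) \<longrightarrow> y \<in> W"
  show "openin Z_omega_topology W"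
    unfolding Z_omega_topology_def openin_product_topology_alt
  proof
    fix x assume "x \<in> W"
    then obtain k where k: "\<And>y. (\<forall>i<k. x i = y i) \<Longrightarrow> y \<in> W" using R by blast
    define U where "U i = (if i < k then {x i} else UNIV)" for i
    have "{i. U i \<noteq> UNIV} \<subseteq> {..<k}" by (auto simp: U_def)
    then have "finite {i. U i \<noteq> UNIV}" by (rule finite_subset) simp
    moreover have "y \<in> W" if "y \<in> Pi\<^sub>E UNIV U" for y
    proof (rule k, intro allI impI)
      fix i assume "i < k"
      moreover have "y i \<in> U i" using that by (simp add: PiE_iff)
      ultimately show "x i = y i" by (simp add: U_def)
    qed
    moreover have "x \<in> Pi\<^sub>E UNIV U" by (auto simp: U_def)
    ultimately show "\<exists>U. finite {i \<in> UNIV. U i \<noteq> topspace (discrete_topology UNIV)} \<and>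
        (\<forall>i\<in>UNIV. openin (discrete_topology UNIV) (U i)) \<and> x \<in> Pi\<^sub>E UNIV U \<and> Pi\<^sub>E UNIV U \<subseteq> W"
      by (intro exI[of _ U]) auto
  qed
qed

text \<open>Cantor's diagonal argument: adding 1 to the diagonal of an enumeration gives a sequence
  that it misses.\<close>

lemma uncountable_int_sequences: "uncountable (UNIV :: (nat \<Rightarrow> int) set)"
proof
  assume "countable (UNIV :: (nat \<Rightarrow> int) set)"
  then have "range (from_nat_into (UNIV :: (nat \<Rightarrow> int) set)) = UNIV"
    by (intro range_from_nat_into) auto
  then obtain n where "(\<lambda>i. from_nat_into UNIV i i + 1 :: int) = from_nat_into UNIV n"
    by (metis UNIV_I imageE)
  then show False by (metis add_cancel_right_right one_neq_zero)
qed

section \<open>Torsion quotients and partial products\<close>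

lemma torsion_FactGroup_iff:
  assumes "K \<lhd> G"
  shows "torsion_group (G Mod K) \<longleftrightarrow> (\<forall>x\<in>carrier G. \<exists>k::nat. k > 0 \<and> x [^]\<^bsub>G\<^esub> k \<in> K)"
proof -
  interpret normal K G by fact
  interpret h: group_hom G "G Mod K" "\<lambda>a. K #>\<^bsub>G\<^esub> a"
    by (simp add: factorgroup_is_group group_hom.intro group_hom_axioms_def is_group r_coset_hom_Mod)
  have "(K #>\<^bsub>G\<^esub> x) [^]\<^bsub>G Mod K\<^esub> k = \<one>\<^bsub>G Mod K\<^esub> \<longleftrightarrow> x [^]\<^bsub>G\<^esub> k \<in> K"
    if "x \<in> carrier G" for x and k :: nat
    using that coset_join1 coset_join2 subgroup_axioms
    by (metis h.hom_nat_pow nat_pow_closed one_FactGroup)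
  moreover have "carrier (G Mod K) = (\<lambda>x. K #>\<^bsub>G\<^esub> x) ` carrier G"
    by (auto simp: FactGroup_def RCOSETS_def)
  ultimately show ?thesis
    unfolding torsion_group_def by simp
qed

text \<open>These approximate the infinite product of the \<open>g i [^] x i\<close>. Stage
  \<open>k\<close> uses only the exponents below \<open>k\<close>, so it is trivial when they all
  vanish.\<close>

primrec partial_product ::
  "('a, 'm) monoid_scheme \<Rightarrow> (nat \<Rightarrow> 'a) \<Rightarrow> (nat \<Rightarrow> int) \<Rightarrow> nat \<Rightarrow> 'a" where
  "partial_product G g x 0 = \<one>\<^bsub>G\<^esub>"
| "partial_product G g x (Suc k) = partial_product G g x k \<otimes>\<^bsub>G\<^esub> (g k [^]\<^bsub>G\<^esub> x k)"

section \<open>Congruence modulo the subgroups of the filtration\<close>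

locale filtered_group = comm_group G for G (structure) +
  fixes T :: "'a topology" and N :: "nat \<Rightarrow> 'a set"
  assumes polish: "polish_group G T"
    and sub: "\<And>n. open_subgroup (N n) G T"
    and dec: "decseq N"
    and base: "neighbourhood_base_at \<one> (\<lambda>V. V \<in> range N) T"
begin

text \<open>Equality of cosets of \<open>N n\<close>. Membership in the carrier is built in, so that
  a congruence alone carries all side conditions.\<close>

definition eqv :: "nat \<Rightarrow> 'a \<Rightarrow> 'a \<Rightarrow> bool" where
  "eqv n x y \<longleftrightarrow> x \<in> carrier G \<and> y \<in> carrier G \<and> inv x \<otimes> y \<in> N n"

lemma topspace_eq [simp]: "topspace T = carrier G"
  using polish by (simp add: polish_group_def topological_group_def)

lemma subgroup_N: "subgroup (N n) G"
  using sub by (simp add: open_subgroup_def)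

lemma N_carrier: "x \<in> N n \<Longrightarrow> x \<in> carrier G"
  using subgroup.subset[OF subgroup_N] by blast

lemma N_antimono: "m \<le> n \<Longrightarrow> x \<in> N n \<Longrightarrow> x \<in> N m"
  using dec by (auto simp: decseq_def)

lemma eqv_carrier: "eqv n x y \<Longrightarrow> x \<in> carrier G \<and> y \<in> carrier G"
  by (simp add: eqv_def)

lemma eqv_refl: "x \<in> carrier G \<Longrightarrow> eqv n x x"
  by (simp add: eqv_def subgroup.one_closed[OF subgroup_N])

lemma eqv_sym: "eqv n x y \<Longrightarrow> eqv n y x"
  unfolding eqv_def
  using subgroup.m_inv_closed[OF subgroup_N, of "inv x \<otimes> y" n] by (simp add: inv_mult_group)

lemma eqv_trans [trans]:
  assumes "eqv n x y" "eqv n y z"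
  shows "eqv n x z"
proof -
  have "(inv x \<otimes> y) \<otimes> (inv y \<otimes> z) \<in> N n"
    using assms unfolding eqv_def by (blast intro: subgroup.m_closed[OF subgroup_N])
  moreover have "(inv x \<otimes> y) \<otimes> (inv y \<otimes> z) = inv x \<otimes> z"
    using assms unfolding eqv_def by (metis inv_closed m_assoc m_closed r_inv r_one)
  ultimately show ?thesis using assms by (simp add: eqv_def)
qed

text \<open>Commutativity enters here: it lets the two differences be regrouped into the difference
  of the products.\<close>

lemma eqv_mult:
  assumes "eqv n x x'" "eqv n y y'"
  shows "eqv n (x \<otimes> y) (x' \<otimes> y')"
proof -
  have "(inv x \<otimes> x') \<otimes> (inv y \<otimes> y') \<in> N n"
    using assms unfolding eqv_def by (blast intro: subgroup.m_closed[OF subgroup_N])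
  moreover have "(inv x \<otimes> x') \<otimes> (inv y \<otimes> y') = inv (x \<otimes> y) \<otimes> (x' \<otimes> y')"
    using assms unfolding eqv_def by (simp add: inv_mult m_ac)
  ultimately show ?thesis using assms by (simp add: eqv_def)
qed

lemma eqv_inv:
  assumes "eqv n x y"
  shows "eqv n (inv x) (inv y)"
proof -
  have "inv (inv x \<otimes> y) \<in> N n"
    using assms unfolding eqv_def by (blast intro: subgroup.m_inv_closed[OF subgroup_N])
  then show ?thesis using assms by (simp add: eqv_def inv_mult)
qed

lemma eqv_antimono: "m \<le> n \<Longrightarrow> eqv n x y \<Longrightarrow> eqv m x y"
  using N_antimono by (auto simp: eqv_def)

lemma eqv_one_iff: "eqv n \<one> x \<longleftrightarrow> x \<in> N n"
  using N_carrier by (auto simp: eqv_def)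

text \<open>Left translations are continuous, so the base at the identity is carried to every point.
  This lets open sets be described through \<open>eqv\<close> alone.\<close>

lemma openin_iff:
  "openin T W \<longleftrightarrow> W \<subseteq> carrier G \<and> (\<forall>x\<in>W. \<exists>n. \<forall>y. eqv n x y \<longrightarrow> y \<in> W)"
proof -
  have mult: "continuous_map (prod_topology T T) T (\<lambda>(x, y). x \<otimes> y)"
    using polish by (simp add: polish_group_def topological_group_def)
  have translate: "continuous_map T T (\<lambda>y. a \<otimes> y)" if "a \<in> carrier G" for a
  proof -
    have "continuous_map T (prod_topology T T) (\<lambda>y. (a, y))"
      using that by (simp add: continuous_map_paired)
    from continuous_map_compose[OF this mult] show ?thesis by (simp add: o_def)
  qed
  show ?thesis
  proof (intro iffI conjI ballI)
    assume W: "openin T W"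
    then show "W \<subseteq> carrier G" using openin_subset topspace_eq by blast
    fix x assume x: "x \<in> W"
    then have xG: "x \<in> carrier G" using \<open>W \<subseteq> carrier G\<close> by blast
    have "openin T {y \<in> carrier G. x \<otimes> y \<in> W}"
      using openin_continuous_map_preimage[OF translate[OF xG] W] by simp
    moreover have "\<one> \<in> {y \<in> carrier G. x \<otimes> y \<in> W}" using x xG by simp
    ultimately obtain n where n: "N n \<subseteq> {y \<in> carrier G. x \<otimes> y \<in> W}"
      using base unfolding neighbourhood_base_at_def by blast
    have "y \<in> W" if "eqv n x y" for y
    proof -
      have "x \<otimes> (inv x \<otimes> y) \<in> W" using n that unfolding eqv_def by blast
      then show ?thesis using that xG by (simp add: eqv_def flip: m_assoc)
    qed
    then show "\<exists>n. \<forall>y. eqv n x y \<longrightarrow> y \<in> W" by blast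
  next
    assume R: "W \<subseteq> carrier G \<and> (\<forall>x\<in>W. \<exists>n. \<forall>y. eqv n x y \<longrightarrow> y \<in> W)"
    show "openin T W"
    proof (subst openin_subopen, intro ballI)
      fix x assume x: "x \<in> W"
      then obtain n where n: "\<And>y. eqv n x y \<Longrightarrow> y \<in> W" using R by blast
      have xG: "x \<in> carrier G" using x R by blast
      have "openin T {y \<in> topspace T. inv x \<otimes> y \<in> N n}"
        using sub xG by (intro openin_continuous_map_preimage[OF translate]) (auto simp: open_subgroup_def)
      moreover have "x \<in> {y \<in> topspace T. inv x \<otimes> y \<in> N n}"
        using xG subgroup.one_closed[OF subgroup_N] by simp
      moreover have "{y \<in> topspace T. inv x \<otimes> y \<in> N n} \<subseteq> W"
        using n xG by (auto simp: eqv_def)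
      ultimately show "\<exists>S. openin T S \<and> x \<in> S \<and> S \<subseteq> W" by blast
    qed
  qed
qed

section \<open>Clopen cosets, separation and completeness\<close>

lemma openin_coset: "openin T {y. eqv n x y}"
  unfolding openin_iff using eqv_carrier eqv_trans by blast

lemma closedin_coset: "closedin T {y. eqv n x y}"
proof -
  have "openin T (carrier G - {y. eqv n x y})"
    unfolding openin_iff using eqv_carrier eqv_trans eqv_sym by blast
  then show ?thesis using eqv_carrier by (auto simp: closedin_def)
qed

lemma eqv_all_imp_eq:
  assumes "\<And>n. eqv n x y"
  shows "x = y"
proof (rule ccontr)
  assume "x \<noteq> y"
  have "Hausdorff_space T"
    using polish completely_metrizable_imp_metrizable_space metrizable_imp_Hausdorff_space
    unfolding polish_group_def by blast
  then obtain U where "openin T U" "x \<in> U" "y \<notin> U"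
    using \<open>x \<noteq> y\<close> eqv_carrier[OF assms] unfolding Hausdorff_space_def
    by (metis disjnt_iff topspace_eq)
  then show False using assms openin_iff by blast
qed

text \<open>A Polish topology only provides some complete metric, which need not be invariant.
  As in the proof that a Polish subgroup of its completion is closed, one writes the ideal limit
  of \<open>s\<close> as a quotient of two elements of the group: shrinking cosets of \<open>b j\<close> and
  of \<open>b j \<otimes> s (m j)\<close> are chosen alternately so that both have vanishing diameter
  in the complete metric.\<close>

lemma complete:
  assumes s: "\<And>k. eqv k (s k) (s (Suc k))"
  shows "\<exists>l. \<forall>k. eqv k (s k) l"
proof -
  have sG: "s k \<in> carrier G" for k using s eqv_carrier by blast
  have s_le: "eqv k (s k) (s j)" if "k \<le> j" for k j
    using that
  proof (induction j rule: dec_induct)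
    case base then show ?case using sG eqv_refl by blast
  next
    case (step j) then show ?case using s eqv_antimono[of k j] eqv_trans by (meson less_imp_le)
  qed
  obtain M d where "Metric_space M d" and mc: "Metric_space.mcomplete M d"
    and T: "T = Metric_space.mtopology M d"
    using polish unfolding polish_group_def completely_metrizable_space_def by blast
  interpret Metric_space M d by fact
  \<comment> \<open>An open ball around \<open>x\<close> contains a coset of some
    \<open>N n\<close>, and a larger index only shrinks the coset.\<close>
  have small: "\<exists>p>m. {y. eqv p x y} \<subseteq> mcball x \<epsilon>" if "x \<in> carrier G" "\<epsilon> > 0" for x m \<epsilon>
  proof -
    have "x \<in> M" using that(1) topspace_eq T by simp
    then have "openin T (mball x \<epsilon>)" "x \<in> mball x \<epsilon>"
      using that by (auto simp: T)
    then obtain n where "\<And>y. eqv n x y \<Longrightarrow> y \<in> mball x \<epsilon>"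
      using openin_iff by blast
    then have "{y. eqv (max n (Suc m)) x y} \<subseteq> mcball x \<epsilon>"
      using eqv_antimono[of n "max n (Suc m)"] mball_subset_mcball by fastforce
    then show ?thesis by (intro exI[of _ "max n (Suc m)"]) auto
  qed
  \<comment> \<open>A state \<open>(b, m)\<close> stands for the cosets of \<open>b\<close> and of
    \<open>b \<otimes> s m\<close> modulo \<open>N m\<close>. A transition shrinks both cosets and
    puts each new one into a closed ball of radius \<open>inverse (real (Suc j))\<close>.\<close>
  define Q where "Q j st st' \<longleftrightarrow> (case st of (b, m) \<Rightarrow> case st' of (b', q) \<Rightarrow>
      m < q \<and> eqv m b b' \<and> eqv m (b \<otimes> s m) (b' \<otimes> s q) \<and>
      (\<exists>c. {y. eqv q b' y} \<subseteq> mcball c (inverse (real (Suc j)))) \<and>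
      (\<exists>c. {y. eqv q (b' \<otimes> s q) y} \<subseteq> mcball c (inverse (real (Suc j)))))" for j :: nat and st st'
  have "\<exists>f. \<forall>j. fst (f j) \<in> carrier G \<and> Q j (f j) (f (Suc j))"
  proof (rule dependent_nat_choice)
    show "\<exists>x. fst x \<in> carrier G" by (auto intro: exI[of _ "(\<one>, 0)"])
    fix st :: "'a \<times> nat" and j :: nat assume st: "fst st \<in> carrier G"
    obtain b m where bm: "st = (b, m)" by fastforce
    have b: "b \<in> carrier G" using st bm by simp
    define \<epsilon> where "\<epsilon> = inverse (real (Suc j))"
    have \<epsilon>: "\<epsilon> > 0" by (simp add: \<epsilon>_def)
    obtain p where p: "p > m" "{y. eqv p (b \<otimes> s m) y} \<subseteq> mcball (b \<otimes> s m) \<epsilon>"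
      using small[of "b \<otimes> s m" \<epsilon> m] b sG \<epsilon> by auto
    \<comment> \<open>The correcting factor lies in \<open>N m\<close>, so \<open>b'\<close> stays
      in the coset of \<open>b\<close>. It is chosen to give
      \<open>b' \<otimes> s p = b \<otimes> s m\<close>, whose coset modulo \<open>N p\<close> is
      already small; the index \<open>q\<close> can then be raised to make the coset of
      \<open>b'\<close> small too.\<close>
    define b' where "b' = b \<otimes> (s m \<otimes> inv (s p))"
    have b': "b' \<in> carrier G" using b sG by (simp add: b'_def)
    have b's: "b' \<otimes> s p = b \<otimes> s m" using b sG by (simp add: b'_def m_assoc)
    obtain q where q: "q > p" "{y. eqv q b' y} \<subseteq> mcball b' \<epsilon>"
      using small[of b' \<epsilon> p] b' \<epsilon> by auto
    have "eqv m b b'"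
    proof -
      have "eqv m (b \<otimes> (s m \<otimes> inv (s m))) b'"
        unfolding b'_def using b sG p(1) by (intro eqv_mult eqv_inv eqv_refl s_le) auto
      then show ?thesis using b sG by simp
    qed
    moreover have pq: "eqv p (b \<otimes> s m) (b' \<otimes> s q)"
      unfolding b's[symmetric] using b' q(1) by (intro eqv_mult eqv_refl s_le) auto
    moreover have "{y. eqv q (b' \<otimes> s q) y} \<subseteq> mcball (b \<otimes> s m) \<epsilon>"
      using p(2) eqv_trans[OF pq] eqv_antimono[of p q] q(1) by fastforce
    ultimately have "Q j st (b', q)"
      using p(1) q eqv_antimono[of m p] unfolding Q_def bm \<epsilon>_def by auto
    then show "\<exists>y. fst y \<in> carrier G \<and> Q j st y" using b' by (intro exI[of _ "(b', q)"]) simp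
  qed
  then obtain f where f: "\<And>j. fst (f j) \<in> carrier G" "\<And>j. Q j (f j) (f (Suc j))" by blast
  define b m where "b j = fst (f j)" and "m j = snd (f j)" for j
  have bG: "b j \<in> carrier G" for j using f(1) by (simp add: b_def)
  have step: "m j < m (Suc j)" "eqv (m j) (b j) (b (Suc j))"
      "eqv (m j) (b j \<otimes> s (m j)) (b (Suc j) \<otimes> s (m (Suc j)))"
      "\<exists>c. {y. eqv (m (Suc j)) (b (Suc j)) y} \<subseteq> mcball c (inverse (real (Suc j)))"
      "\<exists>c. {y. eqv (m (Suc j)) (b (Suc j) \<otimes> s (m (Suc j))) y} \<subseteq> mcball c (inverse (real (Suc j)))" for j
    using f(2)[of j] unfolding Q_def b_def m_def by (auto simp: case_prod_beta)
  \<comment> \<open>Nested nonempty closed sets contained in arbitrarily small balls have a common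
    point, by metric completeness.\<close>
  have nest: "\<exists>z. \<forall>j. eqv (m j) (a j) z"
    if aG: "\<And>j. a j \<in> carrier G" and a: "\<And>j. eqv (m j) (a j) (a (Suc j))"
      and diam: "\<And>j. \<exists>c. {y. eqv (m (Suc j)) (a (Suc j)) y} \<subseteq> mcball c (inverse (real (Suc j)))" for a
  proof -
    define C where "C j = {y. eqv (m j) (a j) y}" for j
    have "closedin mtopology (C j)" for j
      using closedin_coset by (simp add: C_def T)
    moreover have "C j \<noteq> {}" for j using eqv_refl[OF aG] by (auto simp: C_def)
    moreover have "decseq C"
      unfolding C_def decseq_Suc_iff
      using a step(1) eqv_antimono eqv_trans by (metis less_imp_le Collect_mono)
    moreover have "\<exists>n c. C n \<subseteq> mcball c \<epsilon>" if "\<epsilon> > 0" for \<epsilon>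
    proof -
      obtain j where "inverse (real (Suc j)) < \<epsilon>" using reals_Archimedean[OF \<open>\<epsilon> > 0\<close>] by blast
      then have "mcball c (inverse (real (Suc j))) \<subseteq> mcball c \<epsilon>" for c
        by (intro mcball_subset_concentric) simp
      moreover obtain c where "C (Suc j) \<subseteq> mcball c (inverse (real (Suc j)))"
        using diam[of j] unfolding C_def ..
      ultimately show ?thesis by blast
    qed
    ultimately have "\<Inter> (range C) \<noteq> {}" using mc unfolding mcomplete_nest by blast
    then show ?thesis by (auto simp: C_def)
  qed
  obtain y where y: "\<And>j. eqv (m j) (b j) y" using nest[of b] bG step by blast
  obtain z where z: "\<And>j. eqv (m j) (b j \<otimes> s (m j)) z"
    using nest[of "\<lambda>j. b j \<otimes> s (m j)"] bG sG step by blast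
  have lim: "eqv (m j) (s (m j)) (inv y \<otimes> z)" for j
    using eqv_mult[OF eqv_inv[OF y] z, of j] bG sG by (simp flip: m_assoc)
  \<comment> \<open>Congruences are known only at the indices \<open>m j\<close>; these are cofinal,
    which gives every \<open>k\<close>.\<close>
  have m_ge: "k \<le> m k" for k
    using step(1) strict_mono_imp_increasing[of m] by (simp add: strict_mono_Suc_iff)
  have "eqv k (s k) (inv y \<otimes> z)" for k
    using s_le[OF m_ge] eqv_antimono[OF m_ge lim] eqv_trans by blast
  then show ?thesis by blast
qed

section \<open>Embedding the integer sequences by infinite products\<close>

text \<open>The products converge by \<open>complete\<close>, since the factor at \<open>k\<close>
  lies in \<open>N k\<close>. The key fact is \<open>\<phi>_eqv\<close>: congruence modulo
  \<open>N k\<close> means agreement below \<open>k\<close>. It yields injectivity, the closed range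
  and continuity in both directions.\<close>

lemma Z_omega_embeds:
  assumes g: "\<And>k. g k \<in> N k" and ng: "\<And>k n. n > (0::nat) \<Longrightarrow> g k [^] n \<notin> N (Suc k)"
  shows "\<exists>K. closed_subgroup K G T \<and>
    topological_group_iso (G\<lparr>carrier := K\<rparr>) (subtopology T K) Z_omega Z_omega_topology"
proof -
  have gG: "g k \<in> carrier G" for k using g N_carrier by blast
  let ?P = "partial_product G g"
  have PG: "?P x k \<in> carrier G" for x k by (induction k) (auto simp: gG)
  have pow: "g k [^] (z::int) \<in> N k" for k z
    using subgroup_int_pow_closed[OF subgroup_N g] .
  \<comment> \<open>The assumption \<open>ng\<close> concerns positive natural exponents only; a
    negative exponent is treated by passing to the inverse.\<close>
  have pow0: "z = 0" if "g k [^] (z::int) \<in> N (Suc k)" for k z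
  proof (rule ccontr)
    assume "z \<noteq> 0"
    have "g k [^] (- z) \<in> N (Suc k)"
      using that subgroup.m_inv_closed[OF subgroup_N] by (simp add: int_pow_neg gG)
    then have "g k [^] (int (nat \<bar>z\<bar>)) \<in> N (Suc k)" using that by (cases "z \<ge> 0") auto
    then show False using ng[of "nat \<bar>z\<bar>" k] \<open>z \<noteq> 0\<close> unfolding int_pow_int by simp
  qed
  have P_eqv: "eqv k (?P x k) (?P x (Suc k))" for x k
    using eqv_mult[OF eqv_refl[OF PG[of x k]], of k \<one> "g k [^] x k"] PG pow by (simp add: eqv_one_iff)
  have "\<exists>\<phi>. \<forall>x k. eqv k (?P x k) (\<phi> x)"
    using complete[of "?P _"] P_eqv by metis
  then obtain \<phi> where \<phi>: "\<And>x k. eqv k (?P x k) (\<phi> x)" by blast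
  have \<phi>G: "\<phi> x \<in> carrier G" for x using \<phi> eqv_carrier by blast
  have P_add: "?P (\<lambda>i. x i + y i) k = ?P x k \<otimes> ?P y k" for x y k
    by (induction k) (auto simp: gG PG int_pow_mult m_ac)
  have \<phi>_add: "\<phi> (\<lambda>i. x i + y i) = \<phi> x \<otimes> \<phi> y" for x y
  proof (rule eqv_all_imp_eq)
    fix n
    show "eqv n (\<phi> (\<lambda>i. x i + y i)) (\<phi> x \<otimes> \<phi> y)"
      using eqv_sym[OF \<phi>] eqv_mult[OF \<phi>[of n x] \<phi>[of n y]] eqv_trans
      unfolding P_add[symmetric] by blast
  qed
  have P_zero: "?P x k = \<one>" if "\<forall>i<k. x i = 0" for x k
    using that by (induction k) auto
  have \<phi>_N: "\<phi> x \<in> N k \<longleftrightarrow> (\<forall>i<k. x i = 0)" for x k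
  proof
    assume "\<forall>i<k. x i = 0"
    then show "\<phi> x \<in> N k" using \<phi>[of k x] by (simp add: P_zero eqv_one_iff)
  next
    assume xk: "\<phi> x \<in> N k"
    show "\<forall>i<k. x i = 0"
    proof (intro allI impI)
      fix i assume "i < k"
      then show "x i = 0"
      \<comment> \<open>Once the earlier exponents vanish, the partial product at
        \<open>Suc i\<close> is just \<open>g i [^] x i\<close>. It is congruent to
        \<open>\<phi> x\<close>, hence lies in \<open>N (Suc i)\<close>, and \<open>pow0\<close>
        applies.\<close>
      proof (induction i rule: less_induct)
        case (less i)
        then have "?P x (Suc i) = g i [^] x i" by (simp add: P_zero gG)
        then have "eqv (Suc i) (\<phi> x) (g i [^] x i)" using \<phi>[of "Suc i" x] eqv_sym by simp
        moreover have "eqv (Suc i) \<one> (\<phi> x)"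
          using xk less.prems N_antimono[of "Suc i" k] by (simp add: eqv_one_iff)
        ultimately have "g i [^] x i \<in> N (Suc i)" using eqv_trans eqv_one_iff by blast
        then show ?case using pow0 by blast
      qed
    qed
  qed
  have \<phi>_zero: "\<phi> (\<lambda>_. 0) = \<one>"
    using \<phi>_N[of "\<lambda>_. 0"] by (intro eqv_all_imp_eq[symmetric]) (simp add: eqv_one_iff)
  have \<phi>_minus: "\<phi> (\<lambda>i. - x i) = inv (\<phi> x)" for x
    using \<phi>_add[of "\<lambda>i. - x i" x] \<phi>G by (intro inv_equality[symmetric]) (auto simp: \<phi>_zero)
  have \<phi>_eqv: "eqv k (\<phi> x) (\<phi> y) \<longleftrightarrow> (\<forall>i<k. x i = y i)" for k x y
  proof -
    have "eqv k (\<phi> x) (\<phi> y) \<longleftrightarrow> \<phi> (\<lambda>i. - x i + y i) \<in> N k"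
      unfolding \<phi>_add \<phi>_minus using \<phi>G by (simp add: eqv_def)
    also have "\<dots> \<longleftrightarrow> (\<forall>i<k. x i = y i)" unfolding \<phi>_N by auto
    finally show ?thesis .
  qed
  have inj: "inj \<phi>"
  proof (rule injI)
    fix x y assume "\<phi> x = \<phi> y"
    then have "\<forall>i<k. x i = y i" for k using \<phi>_eqv[of k x y] eqv_refl[OF \<phi>G] by simp
    then show "x = y" by (intro ext) blast
  qed
  let ?K = "range \<phi>"
  have subgroup_K: "subgroup ?K G"
  proof (rule subgroupI)
    show "?K \<subseteq> carrier G" using \<phi>G by blast
    show "inv a \<in> ?K" if "a \<in> ?K" for a using that by (auto simp flip: \<phi>_minus)
    show "a \<otimes> b \<in> ?K" if "a \<in> ?K" "b \<in> ?K" for a b using that by (auto simp flip: \<phi>_add)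
  qed auto
  have "closedin T ?K"
  proof -
    have "\<exists>n. \<forall>z. eqv n y z \<longrightarrow> z \<notin> ?K" if y: "y \<in> carrier G" "y \<notin> ?K" for y
    proof (rule ccontr)
      assume "\<not> ?thesis"
      then have "\<forall>n. \<exists>x. eqv n y (\<phi> x)" by blast
      then obtain w where w: "\<And>n. eqv n y (\<phi> (w n))" by metis
      \<comment> \<open>Diagonal limit of the \<open>w n\<close>: for \<open>i < n\<close> both
        \<open>\<phi> (w n)\<close> and \<open>\<phi> (w (Suc i))\<close> are congruent to
        \<open>y\<close> modulo \<open>N (Suc i)\<close>, so \<open>w n\<close> and
        \<open>w (Suc i)\<close> agree at \<open>i\<close>.\<close>
      define x where "x i = w (Suc i) i" for i
      have "eqv n y (\<phi> x)" for n
      proof -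
        have "w n i = x i" if "i < n" for i
        proof -
          have "eqv (Suc i) (\<phi> (w n)) (\<phi> (w (Suc i)))"
            using w eqv_sym eqv_trans eqv_antimono[of "Suc i" n] that by (meson Suc_leI)
          then show ?thesis unfolding \<phi>_eqv x_def by simp
        qed
        then have "eqv n (\<phi> (w n)) (\<phi> x)" by (simp add: \<phi>_eqv)
        then show ?thesis using w eqv_trans by blast
      qed
      then have "y = \<phi> x" by (rule eqv_all_imp_eq)
      then show False using y by simp
    qed
    then have "openin T (carrier G - ?K)"
      unfolding openin_iff using eqv_carrier by (metis Diff_iff Diff_subset)
    then show ?thesis using \<phi>G by (auto simp: closedin_def)
  qed
  moreover have "topological_group_iso (G\<lparr>carrier := ?K\<rparr>) (subtopology T ?K) Z_omega Z_omega_topology"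
  proof -
    have "\<phi> \<in> iso Z_omega (G\<lparr>carrier := ?K\<rparr>)"
      using inj \<phi>_add by (auto simp: iso_def hom_def bij_betw_def)
    moreover have "group Z_omega" by (simp add: Z_omega_def)
    ultimately have "inv_into UNIV \<phi> \<in> iso (G\<lparr>carrier := ?K\<rparr>) Z_omega"
      using group.iso_set_sym by fastforce
    moreover have "homeomorphic_maps Z_omega_topology (subtopology T ?K) \<phi> (inv_into UNIV \<phi>)"
      unfolding homeomorphic_maps_def
    proof (intro conjI ballI)
      show "continuous_map Z_omega_topology (subtopology T ?K) \<phi>"
      proof -
        have "openin Z_omega_topology {x. \<phi> x \<in> U}" if "openin T U" for U
          unfolding openin_Z_omega_iff
        proof
          fix x assume "x \<in> {x. \<phi> x \<in> U}"
          then obtain n where "\<And>y. eqv n (\<phi> x) y \<Longrightarrow> y \<in> U" using \<open>openin T U\<close> openin_iff by blast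
          then show "\<exists>k. \<forall>y. (\<forall>i<k. x i = y i) \<longrightarrow> y \<in> {x. \<phi> x \<in> U}"
            using \<phi>_eqv by blast
        qed
        then show ?thesis
          using \<phi>G by (simp add: continuous_map_in_subtopology) (auto simp: continuous_map)
      qed
      show "continuous_map (subtopology T ?K) Z_omega_topology (inv_into UNIV \<phi>)"
        unfolding continuous_map
      proof (intro conjI allI impI)
        fix W assume W: "openin Z_omega_topology W"
        \<comment> \<open>The union of all cosets of \<open>\<phi> x\<close> modulo
          \<open>N k\<close> whose matching cylinder around \<open>x\<close> lies in
          \<open>W\<close>. It is open and meets the range exactly in the image of
          \<open>W\<close>.\<close>
        define U where "U = {y. \<exists>x\<in>W. \<exists>k. eqv k (\<phi> x) y \<and> (\<forall>x'. (\<forall>i<k. x i = x' i) \<longrightarrow> x' \<in> W)}"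
        have "openin T U"
          unfolding openin_iff
        proof (intro conjI ballI)
          show "U \<subseteq> carrier G" using eqv_carrier by (auto simp: U_def)
          fix y assume "y \<in> U"
          then obtain x k where "x \<in> W" "eqv k (\<phi> x) y" "\<forall>x'. (\<forall>i<k. x i = x' i) \<longrightarrow> x' \<in> W"
            unfolding U_def by blast
          then have "\<forall>z. eqv k y z \<longrightarrow> z \<in> U" unfolding U_def using eqv_trans by blast
          then show "\<exists>n. \<forall>z. eqv n y z \<longrightarrow> z \<in> U" ..
        qed
        moreover have "\<phi> x \<in> U \<longleftrightarrow> x \<in> W" for x
        proof
          show "\<phi> x \<in> U \<Longrightarrow> x \<in> W" by (auto simp: U_def \<phi>_eqv)
          assume "x \<in> W"
          moreover obtain k where "\<forall>x'. (\<forall>i<k. x i = x' i) \<longrightarrow> x' \<in> W"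
            using W \<open>x \<in> W\<close> unfolding openin_Z_omega_iff by blast
          ultimately show "\<phi> x \<in> U" unfolding U_def using eqv_refl[OF \<phi>G] by blast
        qed
        then have "{y \<in> topspace (subtopology T ?K). inv_into UNIV \<phi> y \<in> W} = U \<inter> ?K"
          using inj \<phi>G by auto
        ultimately show "openin (subtopology T ?K) {y \<in> topspace (subtopology T ?K). inv_into UNIV \<phi> y \<in> W}"
          using openin_subtopology by metis
      qed auto
    qed (use inj in \<open>auto simp: f_inv_into_f\<close>)
    ultimately show ?thesis
      unfolding topological_group_iso_def homeomorphic_maps_map by blast
  qed
  ultimately show ?thesis
    using subgroup_K unfolding closed_subgroup_def by (intro exI[of _ ?K] conjI)
qed

section \<open>Passing to the non-torsion quotients\<close>

text \<open>A strictly increasing \<open>r\<close> satisfies \<open>n \<le> r n\<close>, so the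
  thinned filtration is still a base at the identity.\<close>

lemma filtered_group_subseq:
  assumes "strict_mono r"
  shows "filtered_group G T (N \<circ> r)"
proof (unfold_locales)
  show "neighbourhood_base_at \<one> (\<lambda>V. V \<in> range (N \<circ> r)) T"
    unfolding neighbourhood_base_at_def
  proof (intro allI impI)
    fix W assume "openin T W \<and> \<one> \<in> W"
    then obtain n where "N n \<subseteq> W" using base unfolding neighbourhood_base_at_def by blast
    then have "(N \<circ> r) n \<subseteq> W" using N_antimono[OF strict_mono_imp_increasing[OF assms, of n]] by auto
    then show "\<exists>U V. openin T U \<and> V \<in> range (N \<circ> r) \<and> \<one> \<in> U \<and> U \<subseteq> V \<and> V \<subseteq> W"
      using sub[of "r n"] subgroup.one_closed[OF subgroup_N, of "r n"]
      by (intro exI[of _ "(N \<circ> r) n"]) (auto simp: open_subgroup_def)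
  qed
  show "decseq (N \<circ> r)"
    unfolding decseq_def
  proof (intro allI impI subsetI)
    fix m n x assume "m \<le> n" "x \<in> (N \<circ> r) n"
    then show "x \<in> (N \<circ> r) m"
      using N_antimono[of "r m" "r n"] strict_mono_less_eq[OF assms] by simp
  qed
qed (use polish sub in auto)

lemma torsion_Mod_iff:
  "torsion_group ((G\<lparr>carrier := N n\<rparr>) Mod (N (Suc n))) \<longleftrightarrow>
    (\<forall>x\<in>N n. \<exists>k::nat. k > 0 \<and> x [^] k \<in> N (Suc n))"
proof -
  have "N (Suc n) \<lhd> G\<lparr>carrier := N n\<rparr>"
    using subgroup_N N_antimono[of n "Suc n"]
    by (intro normal_restrict_supergroup) (auto simp: normal_iff_subgroup)
  from torsion_FactGroup_iff[OF this] show ?thesis by (simp flip: nat_pow_consistent)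
qed

lemma not_torsion_imp_Z_omega_embeds:
  assumes "infinite {n. \<not> torsion_group ((G\<lparr>carrier := N n\<rparr>) Mod (N (Suc n)))}"
  shows "\<exists>K. closed_subgroup K G T \<and>
    topological_group_iso (G\<lparr>carrier := K\<rparr>) (subtopology T K) Z_omega Z_omega_topology"
proof -
  let ?A = "{n. \<not> torsion_group ((G\<lparr>carrier := N n\<rparr>) Mod (N (Suc n)))}"
  define r where "r = enumerate ?A"
  have r: "strict_mono r" unfolding r_def using strict_mono_enumerate[OF assms] .
  have "r k \<in> ?A" for k unfolding r_def by (rule enumerate_in_set[OF assms])
  then have "\<exists>x\<in>N (r k). \<forall>n::nat. n > 0 \<longrightarrow> x [^] n \<notin> N (Suc (r k))" for k
    unfolding torsion_Mod_iff by blast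
  then obtain g where g: "\<And>k. g k \<in> N (r k)"
    and ng: "\<And>k n. n > (0::nat) \<Longrightarrow> g k [^] n \<notin> N (Suc (r k))" by metis
  interpret sub: filtered_group G T "N \<circ> r" by (rule filtered_group_subseq[OF r])
  show ?thesis
  proof (rule sub.Z_omega_embeds[of g])
    \<comment> \<open>As \<open>r (Suc k)\<close> is at least \<open>Suc (r k)\<close>, the next
      subgroup of the thinned filtration lies inside \<open>N (Suc (r k))\<close>, which already
      excludes these powers.\<close>
    show "g k [^] n \<notin> (N \<circ> r) (Suc k)" if "n > 0" for k and n :: nat
      using ng[OF that] N_antimono[of "Suc (r k)" "r (Suc k)"] r
      by (auto simp: strict_mono_Suc_iff Suc_le_eq)
  qed (use g in auto)
qed

section \<open>Torsion quotients force a countable image\<close>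

lemma involves_imp_not_torsion:
  assumes "involves G T Z_omega Z_omega_topology"
  shows "infinite {n. \<not> torsion_group ((G\<lparr>carrier := N n\<rparr>) Mod (N (Suc n)))}"
proof
  assume "finite {n. \<not> torsion_group ((G\<lparr>carrier := N n\<rparr>) Mod (N (Suc n)))}"
  then obtain n0 where "\<And>n. \<not> torsion_group ((G\<lparr>carrier := N n\<rparr>) Mod (N (Suc n))) \<Longrightarrow> n < n0"
    unfolding finite_nat_iff_bounded by blast
  then have tor: "\<exists>k::nat. k > 0 \<and> x [^] k \<in> N (Suc n)" if "x \<in> N n" "n \<ge> n0" for x n
    using that torsion_Mod_iff by (meson not_le)
  obtain K f where K: "closed_subgroup K G T" and hom: "f \<in> hom (G\<lparr>carrier := K\<rparr>) Z_omega"
    and cont: "continuous_map (subtopology T K) Z_omega_topology f" and surj: "f ` K = UNIV"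
    using assms unfolding involves_def by auto
  have subK: "subgroup K G" using K by (simp add: closed_subgroup_def)
  have KG: "x \<in> carrier G" if "x \<in> K" for x using that subgroup.subset[OF subK] by blast
  have f_mult: "f (x \<otimes> y) = (\<lambda>i. f x i + f y i)" if "x \<in> K" "y \<in> K" for x y
    using hom_mult[OF hom, of x y] that by simp
  have f_one: "f \<one> i = 0" for i
    using fun_cong[OF f_mult[of \<one> \<one>], of i] subgroup.one_closed[OF subK] by simp
  have K_pow: "x [^] k \<in> K" if "x \<in> K" for x and k :: nat
    using that by (induction k) (auto simp: subgroup.one_closed[OF subK] subgroup.m_closed[OF subK])
  have f_pow: "f (x [^] k) i = int k * f x i" if "x \<in> K" for x i and k :: nat
    by (induction k) (auto simp: f_one f_mult K_pow that algebra_simps)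
  \<comment> \<open>Climbing through the torsion quotients one at a time, the exponents
    multiply.\<close>
  have tor_le: "\<exists>k::nat. k > 0 \<and> x [^] k \<in> N n" if "x \<in> N n0" "n0 \<le> n" for x n
    using that(2)
  proof (induction n rule: dec_induct)
    case base show ?case using that(1) KG N_carrier by (intro exI[of _ 1]) auto
  next
    case (step n)
    then obtain k :: nat where k: "k > 0" "x [^] k \<in> N n" by blast
    then obtain l :: nat where "l > 0" "(x [^] k) [^] l \<in> N (Suc n)" using tor step by blast
    then show ?case using k N_carrier[OF that(1)] by (intro exI[of _ "k * l"]) (auto simp: nat_pow_pow)
  qed
  have kill: "f x = (\<lambda>_. 0)" if x: "x \<in> K" "x \<in> N n0" for x
  proof
    fix i
    \<comment> \<open>By continuity coordinate \<open>i\<close> of \<open>f\<close> vanishes on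
      \<open>K\<close> intersected with some \<open>N n\<close>. A positive power of
      \<open>x\<close> lands there, so a positive multiple of the integer \<open>f x i\<close> is
      0.\<close>
    have "openin Z_omega_topology {z. z i = 0}"
      unfolding openin_Z_omega_iff by (auto intro!: exI[of _ "Suc i"])
    from openin_continuous_map_preimage[OF cont this]
    obtain U where U: "openin T U" "{y \<in> K. f y i = 0} = U \<inter> K"
      using KG by (auto simp: openin_subtopology Int_def conj_commute cong: conj_cong)
    have "\<one> \<in> U" using U(2) f_one subgroup.one_closed[OF subK] by blast
    then obtain n where n: "N n \<subseteq> U" using base U(1) unfolding neighbourhood_base_at_def by blast
    \<comment> \<open>The maximum serves both needs: \<open>tor_le\<close> requires an index of at
      least \<open>n0\<close>, and the power must land in \<open>N n\<close>.\<close>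
    obtain k :: nat where k: "k > 0" "x [^] k \<in> N (max n n0)" using tor_le[of x "max n n0"] x by auto
    then have "x [^] k \<in> U \<inter> K" using n N_antimono[of n "max n n0"] K_pow x by auto
    then have "f (x [^] k) i = 0" using U(2) by blast
    then show "f x i = 0" using f_pow x k by auto
  qed
  obtain D where D: "countable D" "D \<subseteq> carrier G" "T closure_of D = carrier G"
    using polish unfolding polish_group_def separable_space_def by auto
  have "\<exists>a\<in>D. eqv n0 x a" if "x \<in> K" for x
  proof -
    have "x \<in> T closure_of D" using D(3) KG that by simp
    moreover have "x \<in> {y. eqv n0 x y}" using KG that eqv_refl by simp
    ultimately show ?thesis using openin_coset[of n0 x] unfolding in_closure_of by blast
  qed
  \<comment> \<open>Each coset of \<open>N n0\<close> is open and so meets the countable dense set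
    \<open>D\<close>. The chosen point \<open>c x\<close> may lie outside \<open>K\<close>; it only
    labels the coset of \<open>x\<close>.\<close>
  then obtain c where c: "\<And>x. x \<in> K \<Longrightarrow> c x \<in> D \<and> eqv n0 x (c x)" by metis
  have f_eq: "f x = f y" if "x \<in> K" "y \<in> K" "c x = c y" for x y
  proof -
    have "eqv n0 x y" using c that eqv_sym eqv_trans by metis
    then have "f (inv x \<otimes> y) = (\<lambda>_. 0)"
      using that kill subgroup.m_closed[OF subK] subgroup.m_inv_closed[OF subK] unfolding eqv_def by blast
    moreover have "f (x \<otimes> (inv x \<otimes> y)) = (\<lambda>i. f x i + f (inv x \<otimes> y) i)"
      using that subgroup.m_closed[OF subK] subgroup.m_inv_closed[OF subK] by (intro f_mult) auto
    moreover have "x \<otimes> (inv x \<otimes> y) = y" using that KG by (simp flip: m_assoc)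
    ultimately show ?thesis by simp
  qed
  have "countable (c ` K)" by (rule countable_subset[OF _ D(1)]) (use c in auto)
  moreover have "f ` K = (\<lambda>a. f (SOME x. x \<in> K \<and> c x = a)) ` c ` K"
  proof -
    have "f (SOME x'. x' \<in> K \<and> c x' = c x) = f x" if "x \<in> K" for x
      using someI[of "\<lambda>x'. x' \<in> K \<and> c x' = c x" x] that f_eq by blast
    then show ?thesis by (force simp: image_image)
  qed
  ultimately have "countable (f ` K)" by simp
  then show False using surj uncountable_int_sequences by simp
qed

end

section \<open>Closing the circle of implications\<close>

lemma topological_group_iso_imp_involves:
  assumes "closed_subgroup K G T"
    and "topological_group_iso (G\<lparr>carrier := K\<rparr>) (subtopology T K) H S"
  shows "involves G T H S"
proof -
  obtain f where "f \<in> iso (G\<lparr>carrier := K\<rparr>) H" "homeomorphic_map (subtopology T K) S f"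
    using assms(2) unfolding topological_group_iso_def by blast
  then show ?thesis
    using assms(1) unfolding involves_def
    by (intro exI[of _ K] exI[of _ f])
      (auto simp: iso_def bij_betw_def homeomorphic_imp_continuous_map)
qed

theorem theorem4p9:
  fixes G :: "('a, 'm) monoid_scheme" and T :: "'a topology" and N :: "nat \<Rightarrow> 'a set"
  assumes "comm_group G"
    and "polish_group G T"
    and "non_archimedean G T"
    and "\<And>n. open_subgroup (N n) G T"
    and "decseq N"
    and "neighbourhood_base_at \<one>\<^bsub>G\<^esub> (\<lambda>V. V \<in> range N) T"
  shows "(involves G T Z_omega Z_omega_topology \<longleftrightarrow>
           (\<exists>K. closed_subgroup K G T \<and>
              topological_group_iso (G\<lparr>carrier := K\<rparr>) (subtopology T K) Z_omega Z_omega_topology))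
       \<and> (involves G T Z_omega Z_omega_topology \<longleftrightarrow>
           infinite {n. \<not> torsion_group ((G\<lparr>carrier := N n\<rparr>) Mod (N (Suc n)))})"
proof -
  interpret filtered_group G T N
    using assms by (simp add: filtered_group_def filtered_group_axioms_def)
  show ?thesis
    \<comment> \<open>The three implications form a cycle (i) to (iii) to (ii) to (i), which gives
      both equivalences.\<close>
    using involves_imp_not_torsion not_torsion_imp_Z_omega_embeds topological_group_iso_imp_involves
    by blast
qed

end
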